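(* Let $n\ge 1$ and $k\ge \ell\ge 2$ be integers. Then $$\left\lfloor \frac{k-1}{\ell-1}\right\rfloor\frac{q^n-1}{q-1}\leq \Delta_{n}^{(k,\ell)}\leq \left\lfloor\frac{k-1}{\ell-1}\cdot \frac{q^n-1}{q-1}\right\rfloor;$$ more precisely, writing $N=\frac{q^n-1}{q-1}$, $$\Delta^{(k,\ell)}_{n}=\max\left\{\sum_{i=1}^{N}t_i \;\middle|\; t_1,\dots,t_N\in\mathbb{Z}_{\ge 0},\ \sum_{i \in I}t_i \leq k-1\ \text{for all } I \subseteq [N] \text{ with } |I|=\ell-1\right\}.$$ As a consequence, if $\ell-1$ divides $k-1$, then $\Delta_{n}^{(k,\ell)}=\frac{k-1}{\ell-1}\cdot\frac{q^n-1}{q-1}$; in particular $\Delta_{n}^{(k,2)}=(k-1)\frac{q^n-1}{q-1}$.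
   Context: Let $\mathcal{K}$ be a field with a discrete valuation $\nu:\mathcal{K}\to\mathbb{Z}\cup\{\infty\}$, valuation ring $\mathcal{O}=\{\lambda:\nu(\lambda)\ge 0\}$, maximal ideal $\mathfrak{m}=\{\lambda:\nu(\lambda)>0\}$, and finite residue field $\mathcal{O}/\mathfrak{m}\cong\mathbb{F}_q$ ($q$ a prime power). Put $|\lambda|=q^{-\nu(\lambda)}$ and, on $\mathcal{K}^n$, $\|\mathbf{v}\|=\max_{i}|v_i|$. Nonzero vectors $\mathbf{u}_1,\dots,\mathbf{u}_m\in\mathcal{K}^n$ are called orthogonal if $\|\lambda_1\mathbf{u}_1+\dots+\lambda_m\mathbf{u}_m\|=\max_i\|\lambda_i\mathbf{u}_i\|$ for all $\lambda_1,\dots,\lambda_m\in\mathcal{K}$. A set $S\subseteq\mathcal{K}^n\setminus\{\mathbf 0\}$ is weakly orthogonal if any two distinct vectors of $S$ are orthogonal; it is $(k,\ell)$-weakly orthogonal if every $E\subseteq S$ of size $k$ contains a weakly orthogonal subset of size $\ell$. $\Delta_n^{(k,\ell)}$ is the maximum size of a $(k,\ell)$-weakly orthogonal subset of $\mathcal{K}^n\setminus\{\mathbf 0\}$. $[N]=\{1,\dots,N\}$.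
   Formalization: The upper bound, the max formula and the divisibility consequence are stated only for ℓ−1 ≤ N: if ℓ−1 > N then Δ = k−1, exceeding the claimed upper bound, and the max is over an unbounded set (e.g. n=1, k=ℓ=3: Δ=2, claimed bound 1). *)

theory Defs
  imports "HOL-Analysis.Analysis" "HOL-Library.Extended"
begin

(* The last clause excludes the trivial valuation. The value group need not be all of the
   integers: a normalized (surjective) valuation is a special case. *)
definition discrete_valuation :: "('a::field \<Rightarrow> int extended) \<Rightarrow> bool" where
  "discrete_valuation \<nu> \<longleftrightarrow>
     (\<forall>x. \<nu> x \<noteq> Minf) \<and>
     (\<forall>x. \<nu> x = Pinf \<longleftrightarrow> x = 0) \<and>
     (\<forall>x y. \<nu> (x * y) = \<nu> x + \<nu> y) \<and>
     (\<forall>x y. min (\<nu> x) (\<nu> y) \<le> \<nu> (x + y)) \<and>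
     (\<exists>x. x \<noteq> 0 \<and> \<nu> x \<noteq> 0)"

definition valuation_ring :: "('a::field \<Rightarrow> int extended) \<Rightarrow> 'a set" where
  "valuation_ring \<nu> = {x. 0 \<le> \<nu> x}"

definition maximal_ideal :: "('a::field \<Rightarrow> int extended) \<Rightarrow> 'a set" where
  "maximal_ideal \<nu> = {x. 0 < \<nu> x}"

(* Only the set of residue classes is needed: a finite field is determined up to isomorphism
   by its number of elements. *)
definition residue_field :: "('a::field \<Rightarrow> int extended) \<Rightarrow> 'a set set" where
  "residue_field \<nu> = valuation_ring \<nu> //
     {(x, y). x \<in> valuation_ring \<nu> \<and> y \<in> valuation_ring \<nu> \<and> x - y \<in> maximal_ideal \<nu>}"

(* Minf is never a value of a valuation; its clause is a dummy. *)
definition absval :: "('a::field \<Rightarrow> int extended) \<Rightarrow> 'a \<Rightarrow> real" where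
  "absval \<nu> x = (case \<nu> x of Fin m \<Rightarrow> real (card (residue_field \<nu>)) powi (- m)
                           | Pinf \<Rightarrow> 0 | Minf \<Rightarrow> 0)"

definition vnorm :: "('a::field \<Rightarrow> int extended) \<Rightarrow> 'a ^ 'n::finite \<Rightarrow> real" where
  "vnorm \<nu> v = Max (range (\<lambda>i. absval \<nu> (v $ i)))"

(* Meant for nonempty lists; orthogonality is a property of a family, so repetitions count. *)
definition val_orthogonal :: "('a::field \<Rightarrow> int extended) \<Rightarrow> ('a ^ 'n::finite) list \<Rightarrow> bool" where
  "val_orthogonal \<nu> us \<longleftrightarrow>
     (\<forall>u\<in>set us. u \<noteq> 0) \<and>
     (\<forall>c :: nat \<Rightarrow> 'a. vnorm \<nu> (\<Sum>i<length us. c i *s us ! i)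
        = Max ((\<lambda>i. vnorm \<nu> (c i *s us ! i)) ` {..<length us}))"

definition weakly_orthogonal :: "('a::field \<Rightarrow> int extended) \<Rightarrow> ('a ^ 'n::finite) set \<Rightarrow> bool" where
  "weakly_orthogonal \<nu> S \<longleftrightarrow>
     0 \<notin> S \<and> (\<forall>u\<in>S. \<forall>v\<in>S. u \<noteq> v \<longrightarrow> val_orthogonal \<nu> [u, v])"

(* As k > 0 in all uses, card E = k forces E to be finite; likewise for F. *)
definition kl_weakly_orthogonal ::
  "('a::field \<Rightarrow> int extended) \<Rightarrow> nat \<Rightarrow> nat \<Rightarrow> ('a ^ 'n::finite) set \<Rightarrow> bool" where
  "kl_weakly_orthogonal \<nu> k l S \<longleftrightarrow>
     0 \<notin> S \<and> (\<forall>E\<subseteq>S. card E = k \<longrightarrow> (\<exists>F\<subseteq>E. card F = l \<and> weakly_orthogonal \<nu> F))"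

(* The dimension n is CARD('n). Max is meaningful only if all (k,l)-weakly orthogonal sets are
   finite and their sizes bounded, i.e. under the next predicate. *)
definition Delta ::
  "'n::finite itself \<Rightarrow> ('a::field \<Rightarrow> int extended) \<Rightarrow> nat \<Rightarrow> nat \<Rightarrow> nat" where
  "Delta _ \<nu> k l = Max (card ` {S :: ('a ^ 'n) set. kl_weakly_orthogonal \<nu> k l S})"

definition Delta_exists ::
  "'n::finite itself \<Rightarrow> ('a::field \<Rightarrow> int extended) \<Rightarrow> nat \<Rightarrow> nat \<Rightarrow> bool" where
  "Delta_exists _ \<nu> k l \<longleftrightarrow>
     (\<forall>S :: ('a ^ 'n) set. kl_weakly_orthogonal \<nu> k l S \<longrightarrow> finite S) \<and>
     finite (card ` {S :: ('a ^ 'n) set. kl_weakly_orthogonal \<nu> k l S})"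

(* The sums t_1 + ... + t_N over which the maximum is taken; t is only relevant on {1..N}. *)
definition admissible_sums :: "nat \<Rightarrow> nat \<Rightarrow> nat \<Rightarrow> nat set" where
  "admissible_sums N k l =
     {\<Sum>i=1..N. t i | t :: nat \<Rightarrow> nat.
        \<forall>I\<subseteq>{1..N}. card I = l - 1 \<longrightarrow> (\<Sum>i\<in>I. t i) \<le> k - 1}"

end

theory Submission
  imports Defs
begin

text \<open>Non-orthogonality \<open>\<parallel>u - c v\<parallel> < \<parallel>u\<parallel>\<close> for some \<open>c\<close> is an equivalence relation on nonzero vectors:
  after scaling to norm 1 it says that the reductions of \<open>u\<close> and \<open>v\<close> modulo the maximal ideal span
  the same line over the residue field. Hence there are \<open>N\<close> classes, all infinite, and a set is
  weakly orthogonal iff it meets each class at most once. So if \<open>l - 1 \<le> N\<close>, then \<open>S\<close> is \<open>(k, l)\<close>-weakly orthogonal iff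
  any \<open>l - 1\<close> classes together contain fewer than \<open>k\<close> of its vectors, and \<open>t\<^sub>i\<close> is the number of
  vectors of \<open>S\<close> in the \<open>i\<close>-th class. The upper bound averages the constraint over the \<open>N\<close> cyclic
  intervals of length \<open>l - 1\<close>.\<close>

subsection \<open>Counting with labels\<close>

lemma admissible_sums_upper:
  assumes "s \<in> admissible_sums N k l" and "l - 1 \<le> N" and "N > 0"
  shows "(l - 1) * s \<le> (k - 1) * N"
proof -
  obtain t where s: "s = (\<Sum>i=1..N. t i)"
    and t: "\<And>I. I \<subseteq> {1..N} \<Longrightarrow> card I = l - 1 \<Longrightarrow> (\<Sum>i\<in>I. t i) \<le> k - 1"
    using assms(1) by (auto simp: admissible_sums_def)
  define m where "m = l - 1"
  \<comment> \<open>For fixed \<open>j\<close> the indices \<open>c i j\<close> with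
    \<open>i < m\<close> form a cyclic interval of length \<open>m\<close>; for fixed
    \<open>i\<close>, \<open>c i\<close> is a rotated enumeration of \<open>{1..N}\<close>. Summing
    \<open>t\<close> over all \<open>N\<close> intervals therefore counts each index
    \<open>m\<close> times.\<close>
  define c where "c i j = Suc ((j + i) mod N)" for i j :: nat
  have bij: "bij_betw (c i) {..<N} {1..N}" for i
  proof -
    have "inj_on (c i) {..<N}"
    proof (rule inj_onI)
      have le: "y \<le> x" if "(x + i) mod N = (y + i) mod N" "y < N" for x y
      proof (rule ccontr)
        assume "\<not> y \<le> x"
        with that mod_eq_dvd_iff_nat[of "x + i" "y + i" N] have "N dvd y - x" by simp
        with \<open>\<not> y \<le> x\<close> \<open>y < N\<close> show False by (auto dest: dvd_imp_le)
      qed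
      fix x y assume "x \<in> {..<N}" "y \<in> {..<N}" "c i x = c i y"
      with le[of x y] le[of y x] show "x = y" by (simp add: c_def)
    qed
    moreover have "c i ` {..<N} \<subseteq> {1..N}"
      using assms(3) by (auto simp: c_def Suc_le_eq)
    ultimately show ?thesis
      by (simp add: bij_betw_def card_image card_subset_eq)
  qed
  \<comment> \<open>\<open>c\<close> is symmetric in its two arguments, so this is the previous
    bijection read in the other one. The bound \<open>l - 1 \<le> N\<close> keeps an interval from
    overlapping itself.\<close>
  have inj: "inj_on (\<lambda>i. c i j) {..<m}" for j
  proof (rule inj_on_subset)
    show "inj_on (\<lambda>i. c i j) {..<N}"
      using bij[of j] by (simp add: c_def[abs_def] bij_betw_def add.commute)
  qed (use assms(2) in \<open>auto simp: m_def\<close>)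
  have "m * s = (\<Sum>i<m. \<Sum>j<N. t (c i j))"
    using sum.reindex_bij_betw[OF bij, of t] by (simp add: s)
  also have "\<dots> = (\<Sum>j<N. \<Sum>i<m. t (c i j))"
    by (rule sum.swap)
  also have "\<dots> \<le> (\<Sum>j<N. k - 1)"
  proof (rule sum_mono)
    fix j
    have "(\<Sum>i<m. t (c i j)) = sum t ((\<lambda>i. c i j) ` {..<m})"
      using inj by (simp add: sum.reindex)
    also have "\<dots> \<le> k - 1"
    proof (rule t)
      show "(\<lambda>i. c i j) ` {..<m} \<subseteq> {1..N}"
        using assms(3) by (auto simp: c_def Suc_le_eq)
      show "card ((\<lambda>i. c i j) ` {..<m}) = l - 1"
        using inj by (simp add: card_image m_def)
    qed
    finally show "(\<Sum>i<m. t (c i j)) \<le> k - 1" .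
  qed
  finally show ?thesis by (simp add: m_def mult.commute)
qed

text \<open>Makes the maximum over the feasible sums meaningful. For \<open>l - 1 > N\<close> no
  \<open>I\<close> would constrain \<open>t\<close>, and for \<open>l = 1\<close> only the empty one
  would.\<close>

lemma finite_admissible_sums:
  assumes "l \<ge> 2" and "l - 1 \<le> N"
  shows "finite (admissible_sums N k l)"
proof (rule finite_subset)
  show "admissible_sums N k l \<subseteq> {..(k - 1) * N}"
  proof
    fix s assume "s \<in> admissible_sums N k l"
    with assms have "(l - 1) * s \<le> (k - 1) * N"
      by (intro admissible_sums_upper) auto
    moreover have "1 * s \<le> (l - 1) * s" using assms by (intro mult_right_mono) auto
    ultimately show "s \<in> {..(k - 1) * N}" by (simp only: mult_1 atMost_iff)
  qed
qed simp

text \<open>The even distribution is feasible, because \<open>l - 1\<close> copies of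
  \<open>(k - 1) div (l - 1)\<close> add up to at most \<open>k - 1\<close>. This is the source of
  the lower bound.\<close>

lemma admissible_sums_constant: "((k - 1) div (l - 1)) * N \<in> admissible_sums N k l"
  unfolding admissible_sums_def
  by (intro CollectI exI[of _ "\<lambda>_. (k - 1) div (l - 1)"]) (auto simp: mult.commute)

section \<open>Labelled sets and their fibres\<close>

lemma transversal_of_card:
  assumes "l \<le> card (f ` E)"
  obtains F where "F \<subseteq> E" "card F = l" "inj_on f F"
proof -
  obtain T where T: "T \<subseteq> f ` E" "card T = l"
    using obtain_subset_with_card_n[OF assms] by metis
  then obtain F where "F \<subseteq> E" "inj_on f F" "T = f ` F"
    using subset_image_inj by metis
  with T show ?thesis using that card_image by metis
qed

text \<open>With \<open>f\<close> the index of the class of a vector, \<open>spread\<close> becomes \<open>(k, l)\<close>-weak orthogonality.\<close>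

locale labelling =
  fixes V :: "'v set" and f :: "'v \<Rightarrow> nat" and N :: nat
  assumes f_range: "v \<in> V \<Longrightarrow> f v \<in> {1..N}"
    and infinite_fibre: "i \<in> {1..N} \<Longrightarrow> infinite {v \<in> V. f v = i}"
begin

definition spread :: "nat \<Rightarrow> nat \<Rightarrow> 'v set \<Rightarrow> bool" where
  "spread k l S \<longleftrightarrow>
     S \<subseteq> V \<and> (\<forall>E\<subseteq>S. card E = k \<longrightarrow> (\<exists>F\<subseteq>E. card F = l \<and> inj_on f F))"

text \<open>Otherwise some \<open>k\<close> elements have all their labels in \<open>I\<close>, and
  \<open>l\<close> of them would need distinct labels among only \<open>l - 1\<close>. Finiteness is
  asserted separately because an infinite set has \<open>card\<close> 0.\<close>

lemma spread_fibres:
  assumes "spread k l S" "card I = l - 1" "l \<ge> 2" "k \<ge> l"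
  shows "finite {v \<in> S. f v \<in> I} \<and> card {v \<in> S. f v \<in> I} \<le> k - 1"
proof (rule ccontr)
  let ?X = "{v \<in> S. f v \<in> I}"
  assume neg: "\<not> ?thesis"
  have "\<exists>E\<subseteq>?X. card E = k"
  proof (cases "finite ?X")
    case True
    with neg have "k \<le> card ?X" by simp
    then show ?thesis by (metis obtain_subset_with_card_n)
  next
    case False
    then show ?thesis using infinite_arbitrarily_large by metis
  qed
  then obtain E where E: "E \<subseteq> ?X" "card E = k" by metis
  then obtain F where F: "F \<subseteq> E" "card F = l" "inj_on f F"
    using assms(1) unfolding spread_def by (metis (no_types, lifting) mem_Collect_eq subset_iff)
  have "finite I" using assms card.infinite by fastforce
  then have "card F \<le> card I"
    using F E by (intro card_inj_on_le[of f]) auto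
  with F assms show False by simp
qed

text \<open>Converse of \<open>spread_fibres\<close>. The labels of a bad \<open>k\<close>-subset
  number at most \<open>l - 1\<close> and can be enlarged to an \<open>I\<close> of exactly that
  size, for which \<open>l - 1 \<le> N\<close> leaves room; the fibre over \<open>I\<close> would
  then be too large.\<close>

lemma spreadI:
  assumes "S \<subseteq> V" "finite S" "l \<ge> 2" "k \<ge> l" "l - 1 \<le> N"
    and "\<And>I. I \<subseteq> {1..N} \<Longrightarrow> card I = l - 1 \<Longrightarrow> card {v \<in> S. f v \<in> I} \<le> k - 1"
  shows "spread k l S"
  unfolding spread_def
proof (intro conjI allI impI)
  fix E assume E: "E \<subseteq> S" "card E = k"
  have "l \<le> card (f ` E)"
  proof (rule ccontr)
    assume "\<not> l \<le> card (f ` E)"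
    then have "card (f ` E) \<le> l - 1" by simp
    moreover have "f ` E \<subseteq> {1..N}" using E assms(1) f_range by blast
    ultimately obtain I where I: "f ` E \<subseteq> I" "I \<subseteq> {1..N}" "card I = l - 1"
      using exists_subset_between[of "f ` E" "l - 1" "{1..N}"] assms(5) by auto
    have "card E \<le> card {v \<in> S. f v \<in> I}"
      using E I assms(2) by (intro card_mono) auto
    with assms(6)[OF I(2,3)] E assms show False by simp
  qed
  then show "\<exists>F\<subseteq>E. card F = l \<and> inj_on f F"
    by (metis transversal_of_card)
qed (fact assms)

lemma card_fibres:
  assumes "finite S" "finite I"
  shows "card {v \<in> S. f v \<in> I} = (\<Sum>i\<in>I. card {v \<in> S. f v = i})"
proof -
  have "{v \<in> S. f v \<in> I} = (\<Union>i\<in>I. {v \<in> S. f v = i})" by auto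
  also have "card \<dots> = (\<Sum>i\<in>I. card {v \<in> S. f v = i})"
    using assms by (intro card_UN_disjoint) auto
  finally show ?thesis .
qed

lemma spread_finite:
  assumes "spread k l S" "l \<ge> 2" "k \<ge> l"
  shows "finite S"
proof -
  have "finite {v \<in> S. f v = i}" if "i \<in> {1..N}" for i
  proof -
    \<comment> \<open>\<open>I\<close> may leave \<open>{1..N}\<close>, as
      \<open>spread_fibres\<close> accepts any index set; this covers \<open>N < l - 1\<close> as
      well.\<close>
    obtain I where "i \<in> I" "card I = l - 1"
    proof -
      have "card {i..<i + (l - 1)} = l - 1" by simp
      moreover have "i \<in> {i..<i + (l - 1)}" using assms by simp
      ultimately show ?thesis using that by blast
    qed
    then show ?thesis
      using spread_fibres[OF assms(1) _ assms(2,3), of I] by (auto elim: rev_finite_subset)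
  qed
  moreover have "S = (\<Union>i\<in>{1..N}. {v \<in> S. f v = i})"
    using assms(1) f_range unfolding spread_def by auto
  ultimately show ?thesis by (metis (no_types, lifting) finite_UN finite_atLeastAtMost)
qed

text \<open>The fibre sizes of a spread set form a feasible \<open>t\<close>. Conversely every
  feasible \<open>t\<close> is realised by picking \<open>t i\<close> elements with label
  \<open>i\<close>, which is possible because the fibres are infinite.\<close>

lemma card_spread:
  assumes "l \<ge> 2" "k \<ge> l" "l - 1 \<le> N"
  shows "card ` {S. spread k l S} = admissible_sums N k l"
proof (intro equalityI subsetI)
  fix s assume "s \<in> card ` {S. spread k l S}"
  then obtain S where S: "spread k l S" "s = card S" by auto
  have fin: "finite S" using spread_finite S assms by blast
  have "{v \<in> S. f v \<in> {1..N}} = S" using S f_range unfolding spread_def by blast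
  then have "s = (\<Sum>i=1..N. card {v \<in> S. f v = i})"
    using card_fibres[OF fin, of "{1..N}"] S by simp
  moreover have "(\<Sum>i\<in>I. card {v \<in> S. f v = i}) \<le> k - 1"
    if "I \<subseteq> {1..N}" "card I = l - 1" for I
    using spread_fibres[OF S(1) that(2) assms(1,2)] card_fibres[OF fin, of I] that
    by (simp add: finite_subset)
  ultimately show "s \<in> admissible_sums N k l"
    unfolding admissible_sums_def by blast
next
  fix s assume "s \<in> admissible_sums N k l"
  then obtain t where s: "s = (\<Sum>i=1..N. t i)"
    and t: "\<And>I. I \<subseteq> {1..N} \<Longrightarrow> card I = l - 1 \<Longrightarrow> (\<Sum>i\<in>I. t i) \<le> k - 1"
    by (auto simp: admissible_sums_def)
  have "\<exists>T. finite T \<and> card T = t i \<and> T \<subseteq> {v \<in> V. f v = i}" if "i \<in> {1..N}" for i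
    using infinite_arbitrarily_large[OF infinite_fibre[OF that]] by metis
  then obtain T where T: "\<And>i. i \<in> {1..N} \<Longrightarrow>
      finite (T i) \<and> card (T i) = t i \<and> T i \<subseteq> {v \<in> V. f v = i}"
    by metis
  define S where "S = (\<Union>i\<in>{1..N}. T i)"
  have fin: "finite S" using T by (simp add: S_def)
  have SV: "S \<subseteq> V" using T by (fastforce simp: S_def)
  have fibre: "{v \<in> S. f v = i} = T i" if "i \<in> {1..N}" for i
    using T that unfolding S_def by blast
  have sums: "card {v \<in> S. f v \<in> I} = (\<Sum>i\<in>I. t i)" if "I \<subseteq> {1..N}" for I
  proof -
    have "card {v \<in> S. f v \<in> I} = (\<Sum>i\<in>I. card {v \<in> S. f v = i})"
      using fin that by (simp add: card_fibres finite_subset)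
    also have "\<dots> = (\<Sum>i\<in>I. t i)"
      using that fibre T by (intro sum.cong) (auto dest!: subsetD)
    finally show ?thesis .
  qed
  have "spread k l S"
    using SV fin assms t sums by (intro spreadI) auto
  moreover have "card S = s"
  proof -
    have "{v \<in> S. f v \<in> {1..N}} = S" using SV f_range by blast
    with sums[of "{1..N}"] s show ?thesis by simp
  qed
  ultimately show "s \<in> card ` {S. spread k l S}" by blast
qed

text \<open>With so few labels no \<open>l\<close> elements have distinct ones, so a spread set is
  just a set without \<open>k\<close>-subsets. This case is separate because no \<open>I\<close> of
  size \<open>l - 1\<close> fits into \<open>{1..N}\<close>, so \<open>admissible_sums\<close>
  contains arbitrarily large sums.\<close>

lemma card_spread_degenerate:
  assumes "l \<ge> 2" "k \<ge> l" "N < l - 1" "N > 0"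
  shows "card ` {S. spread k l S} = {..k - 1}"
proof (intro equalityI subsetI)
  fix s assume "s \<in> card ` {S. spread k l S}"
  then obtain S where S: "spread k l S" "s = card S" by auto
  have "card {1..l - 1} = l - 1" by simp
  moreover have "{v \<in> S. f v \<in> {1..l - 1}} = S"
    using S assms f_range unfolding spread_def by fastforce
  ultimately show "s \<in> {..k - 1}"
    using spread_fibres[OF S(1), of "{1..l - 1}"] assms S by simp
next
  fix s assume s: "s \<in> {..k - 1}"
  have "infinite V"
    using infinite_fibre[of 1] assms by (auto elim: contrapos_nn intro: finite_subset)
  then obtain S where S: "S \<subseteq> V" "finite S" "card S = s"
    using infinite_arbitrarily_large by metis
  have "spread k l S"
    unfolding spread_def
  proof (intro conjI allI impI)
    fix E assume "E \<subseteq> S" "card E = k"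
    moreover have "card E \<le> card S" using S(2) \<open>E \<subseteq> S\<close> by (rule card_mono)
    ultimately show "\<exists>F\<subseteq>E. card F = l \<and> inj_on f F"
      using S s assms by simp
  qed (fact S)
  with S show "s \<in> card ` {S. spread k l S}" by blast
qed

end

subsection \<open>Orthogonality over a valued field\<close>

locale valued_field =
  fixes \<nu> :: "'a::field \<Rightarrow> int extended"
  assumes valuation: "discrete_valuation \<nu>"
    and finite_residue: "finite (residue_field \<nu>)"
begin

abbreviation q :: nat where "q \<equiv> card (residue_field \<nu>)"
abbreviation A :: "'a \<Rightarrow> real" where "A \<equiv> absval \<nu>"
abbreviation nrm :: "'a ^ 'n::finite \<Rightarrow> real" where "nrm \<equiv> vnorm \<nu>"

lemma val_zero [simp]: "\<nu> 0 = Pinf"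
  using valuation by (simp add: discrete_valuation_def)

lemma val_mult: "\<nu> (x * y) = \<nu> x + \<nu> y"
  using valuation by (simp add: discrete_valuation_def)

lemma val_add: "min (\<nu> x) (\<nu> y) \<le> \<nu> (x + y)"
  using valuation by (simp add: discrete_valuation_def)

lemma val_nonzero:
  assumes "x \<noteq> 0"
  obtains m where "\<nu> x = Fin m"
  using assms valuation unfolding discrete_valuation_def by (metis extended.exhaust)

lemma val_one [simp]: "\<nu> 1 = 0"
proof -
  obtain m where m: "\<nu> 1 = Fin m" using val_nonzero[of 1] by auto
  with val_mult[of 1 1] show ?thesis by (simp add: zero_extended_def)
qed

lemma val_minus [simp]: "\<nu> (- x) = \<nu> x"
proof (cases "x = 0")
  case False
  obtain m where m: "\<nu> x = Fin m" using val_nonzero False by metis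
  obtain j where j: "\<nu> (- x) = Fin j" using val_nonzero[of "- x"] False by auto
  \<comment> \<open>Equal squares give \<open>j + j = m + m\<close> in the integers.\<close>
  have "\<nu> (- x * - x) = \<nu> (x * x)" by simp
  then show ?thesis by (simp only: val_mult m j) simp
qed simp

definition residue_rel :: "('a \<times> 'a) set" where
  "residue_rel = {(x, y). x \<in> valuation_ring \<nu> \<and> y \<in> valuation_ring \<nu> \<and> x - y \<in> maximal_ideal \<nu>}"

lemma residue_field_eq: "residue_field \<nu> = valuation_ring \<nu> // residue_rel"
  by (simp add: residue_field_def residue_rel_def)

lemma maximal_ideal_add:
  "x \<in> maximal_ideal \<nu> \<Longrightarrow> y \<in> maximal_ideal \<nu> \<Longrightarrow> x + y \<in> maximal_ideal \<nu>"
  using val_add[of x y] by (auto simp: maximal_ideal_def min_def split: if_splits)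

lemma equiv_residue_rel: "equiv (valuation_ring \<nu>) residue_rel"
proof (rule equivI)
  show "residue_rel \<subseteq> valuation_ring \<nu> \<times> valuation_ring \<nu>"
    by (auto simp: residue_rel_def)
  show "refl_on (valuation_ring \<nu>) residue_rel"
    by (auto simp: refl_on_def residue_rel_def maximal_ideal_def zero_extended_def)
  show "sym residue_rel"
  proof (rule symI)
    fix x y assume "(x, y) \<in> residue_rel"
    moreover have "\<nu> (x - y) = \<nu> (y - x)" using val_minus[of "x - y"] by simp
    ultimately show "(y, x) \<in> residue_rel"
      by (auto simp: residue_rel_def maximal_ideal_def)
  qed
  show "trans residue_rel"
  proof (rule transI)
    fix x y z assume "(x, y) \<in> residue_rel" "(y, z) \<in> residue_rel"
    then show "(x, z) \<in> residue_rel"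
      using maximal_ideal_add[of "x - y" "y - z"] by (simp add: residue_rel_def)
  qed
qed

lemma zero_in_ring: "0 \<in> valuation_ring \<nu>" and one_in_ring: "1 \<in> valuation_ring \<nu>"
  by (auto simp: valuation_ring_def)

text \<open>0 and 1 lie in different residue classes. This makes \<open>q\<close> a base greater
  than 1, so that \<open>absval\<close> strictly reverses the order of the valuation, and lets
  \<open>q - 1\<close> be a divisor later.\<close>

lemma q_ge_2: "q \<ge> 2"
proof -
  let ?c = "\<lambda>x. residue_rel `` {x}"
  have "(1, 0) \<notin> residue_rel"
    by (simp add: residue_rel_def maximal_ideal_def)
  then have "?c 1 \<noteq> ?c 0"
    using eq_equiv_class[OF _ equiv_residue_rel zero_in_ring] by blast
  then have "card {?c 1, ?c 0} = 2" by simp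
  moreover have "{?c 1, ?c 0} \<subseteq> residue_field \<nu>"
    using zero_in_ring one_in_ring by (auto simp: residue_field_eq quotient_def)
  ultimately show ?thesis using card_mono[OF finite_residue] by metis
qed

section \<open>The absolute value\<close>

lemma absval_zero [simp]: "A 0 = 0"
  by (simp add: absval_def)

lemma absval_pos: "x \<noteq> 0 \<Longrightarrow> A x > 0"
  using q_ge_2 by (auto simp: absval_def elim!: val_nonzero)

lemma absval_nonneg [simp]: "A x \<ge> 0"
  using absval_pos[of x] by (cases "x = 0") auto

lemma absval_eq_0_iff [simp]: "A x = 0 \<longleftrightarrow> x = 0"
  using absval_pos[of x] by (cases "x = 0") auto

lemma absval_one [simp]: "A 1 = 1"
  by (simp add: absval_def zero_extended_def)

lemma absval_mult: "A (x * y) = A x * A y"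
proof (cases "x = 0 \<or> y = 0")
  case False
  then obtain m j where "\<nu> x = Fin m" "\<nu> y = Fin j" using val_nonzero by metis
  then show ?thesis using q_ge_2 by (simp add: absval_def val_mult flip: power_int_add)
qed auto

lemma absval_divide: "A (x / y) = A x / A y"
proof (cases "y = 0")
  case False
  then have "A (x / y) * A y = A x" by (simp flip: absval_mult)
  with False show ?thesis by (simp add: field_simps)
qed simp

lemma absval_power: "A (x ^ n) = A x ^ n"
  by (induction n) (auto simp: absval_mult)

text \<open>Powers of \<open>q > 1\<close> are strictly monotone in the exponent. Through this lemma
  the ring, the ideal and the ultrametric inequality are restated in terms of
  \<open>A\<close>.\<close>

lemma absval_mono: "\<nu> x \<le> \<nu> y \<longleftrightarrow> A y \<le> A x"
proof (cases "x = 0 \<or> y = 0")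
  case True
  show ?thesis
  proof (cases "y = 0")
    case False
    then obtain j where "\<nu> y = Fin j" using val_nonzero by metis
    moreover have "x = 0" using True False by simp
    ultimately show ?thesis using absval_pos[OF False] by simp
  qed simp
next
  case False
  then obtain m j where mj: "\<nu> x = Fin m" "\<nu> y = Fin j" using val_nonzero by metis
  have "real q powi (- j) \<le> real q powi (- m) \<longleftrightarrow> - j \<le> - m"
    using q_ge_2 power_int_increasing[of "- j" "- m" "real q"]
      power_int_strict_increasing[of "- m" "- j" "real q"] by linarith
  then show ?thesis using mj by (simp add: absval_def)
qed

lemma ring_iff: "x \<in> valuation_ring \<nu> \<longleftrightarrow> A x \<le> 1"
  using absval_mono[of 1 x] by (simp add: valuation_ring_def)

lemma ideal_iff: "x \<in> maximal_ideal \<nu> \<longleftrightarrow> A x < 1"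
proof -
  have "\<nu> x \<le> 0 \<longleftrightarrow> 1 \<le> A x" using absval_mono[of x 1] by simp
  then show ?thesis by (simp add: maximal_ideal_def less_le_not_le) (metis linear)
qed

lemma absval_minus [simp]: "A (- x) = A x"
  by (simp add: absval_def)

lemma absval_add: "A (x + y) \<le> max (A x) (A y)"
proof (cases "\<nu> x \<le> \<nu> y")
  case True
  with val_add[of x y] have "\<nu> x \<le> \<nu> (x + y)" by (simp add: min_def)
  then show ?thesis by (simp add: absval_mono le_max_iff_disj)
next
  case False
  with val_add[of x y] have "\<nu> y \<le> \<nu> (x + y)" by (simp add: min_def)
  then show ?thesis by (simp add: absval_mono le_max_iff_disj)
qed

text \<open>Real form of the nontriviality clause of \<open>discrete_valuation\<close>; the powers
  of such an \<open>x\<close> will make every class infinite.\<close>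

lemma absval_nontrivial: "\<exists>x. A x \<noteq> 0 \<and> A x \<noteq> 1"
proof -
  obtain x where x: "x \<noteq> 0" "\<nu> x \<noteq> \<nu> 1"
    using valuation unfolding discrete_valuation_def by (metis val_one)
  then have "A x \<noteq> A 1" using absval_mono by (metis order_antisym order_refl)
  with x show ?thesis by auto
qed

text \<open>Vectors with coordinates in \<open>R\<close> will stand for vectors over the residue
  field, so that no field structure on the quotient has to be built.\<close>

lemma residue_representatives:
  obtains R where "finite R" "card R = q" "0 \<in> R" "\<And>r. r \<in> R \<Longrightarrow> A r \<le> 1"
    "\<And>x. A x \<le> 1 \<Longrightarrow> \<exists>r\<in>R. A (x - r) < 1"
    "\<And>r s. r \<in> R \<Longrightarrow> s \<in> R \<Longrightarrow> A (r - s) < 1 \<Longrightarrow> r = s"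
proof -
  \<comment> \<open>Arbitrary choice might represent the zero class by a nonzero element; taking 0
    there makes every nonzero representative a unit.\<close>
  define g where "g C = (if (0::'a) \<in> C then 0 else SOME y. y \<in> C)" for C
  have g: "g C \<in> C" if "C \<in> residue_field \<nu>" for C
    using in_quotient_imp_non_empty[OF equiv_residue_rel] that
    by (auto simp: g_def residue_field_eq some_in_eq)
  have uniq: "C = D" if "C \<in> residue_field \<nu>" "D \<in> residue_field \<nu>"
     "(x, y) \<in> residue_rel" "x \<in> C" "y \<in> D" for C D x y
    using quotient_eqI[OF equiv_residue_rel] that unfolding residue_field_eq by metis
  have ring: "g C \<in> valuation_ring \<nu>" if "C \<in> residue_field \<nu>" for C
    using g[OF that] in_quotient_imp_subset[OF equiv_residue_rel] that
    unfolding residue_field_eq by blast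
  have rel: "(x, x) \<in> residue_rel" if "x \<in> valuation_ring \<nu>" for x
    using equiv_residue_rel that by (auto simp: equiv_def refl_on_def)
  have inj: "inj_on g (residue_field \<nu>)"
    using g uniq rel ring by (intro inj_onI) metis
  show ?thesis
  proof
    show "finite (g ` residue_field \<nu>)" using finite_residue by simp
    show "card (g ` residue_field \<nu>) = q" using inj by (rule card_image)
    have "residue_rel `` {0} \<in> residue_field \<nu>"
      using zero_in_ring by (auto simp: residue_field_eq intro: quotientI)
    moreover have "g (residue_rel `` {0}) = 0"
      using rel[OF zero_in_ring] by (simp add: g_def)
    ultimately show "0 \<in> g ` residue_field \<nu>" by (metis image_eqI)
    show "A r \<le> 1" if "r \<in> g ` residue_field \<nu>" for r
      using that ring ring_iff by auto
    show "\<exists>r\<in>g ` residue_field \<nu>. A (x - r) < 1" if "A x \<le> 1" for x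
    proof
      have C: "residue_rel `` {x} \<in> residue_field \<nu>"
        using that by (auto simp: residue_field_eq ring_iff intro: quotientI)
      then show "g (residue_rel `` {x}) \<in> g ` residue_field \<nu>" by simp
      show "A (x - g (residue_rel `` {x})) < 1"
        using g[OF C] ideal_iff unfolding residue_rel_def by blast
    qed
    show "r = s" if rs: "r \<in> g ` residue_field \<nu>" "s \<in> g ` residue_field \<nu>" "A (r - s) < 1" for r s
    proof -
      obtain C D where CD: "C \<in> residue_field \<nu>" "D \<in> residue_field \<nu>" "r = g C" "s = g D"
        using rs by auto
      then have "(r, s) \<in> residue_rel" using rs ring by (simp add: residue_rel_def ideal_iff)
      then have "C = D" using uniq CD g by metis
      with CD show ?thesis by simp
    qed
  qed
qed

section \<open>The maximum norm\<close>

lemma absval_le_vnorm: "A (v $ i) \<le> nrm v"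
  unfolding vnorm_def by (rule Max_ge) auto

lemma vnorm_attained: "\<exists>i. nrm v = A (v $ i)"
proof -
  have "nrm v \<in> range (\<lambda>i. A (v $ i))"
    unfolding vnorm_def by (rule Max_in) auto
  then show ?thesis by auto
qed

lemma vnorm_le_iff: "nrm v \<le> b \<longleftrightarrow> (\<forall>i. A (v $ i) \<le> b)"
  using vnorm_attained[of v] absval_le_vnorm[of v] by (metis order_trans)

lemma vnorm_less_iff: "nrm v < b \<longleftrightarrow> (\<forall>i. A (v $ i) < b)"
  using vnorm_attained[of v] absval_le_vnorm[of v] by (metis order_le_less_trans)

lemma vnorm_zero [simp]: "nrm 0 = 0"
  using vnorm_attained[of 0] by auto

lemma vnorm_nonneg [simp]: "nrm v \<ge> 0"
  using vnorm_attained[of v] by auto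

lemma vnorm_eq_0_iff [simp]: "nrm v = 0 \<longleftrightarrow> v = 0"
proof
  assume "nrm v = 0"
  then have "A (v $ i) = 0" for i
    using absval_le_vnorm[of v i] absval_nonneg[of "v $ i"] by linarith
  then show "v = 0" by (simp add: vec_eq_iff)
qed simp

lemma vnorm_pos_iff [simp]: "0 < nrm v \<longleftrightarrow> v \<noteq> 0"
  using vnorm_nonneg[of v] vnorm_eq_0_iff[of v] by linarith

lemma vnorm_scale: "nrm (c *s v) = A c * nrm v"
proof (rule antisym)
  show "nrm (c *s v) \<le> A c * nrm v"
    by (simp add: vnorm_le_iff absval_mult absval_le_vnorm mult_left_mono)
  obtain i where "nrm v = A (v $ i)" using vnorm_attained by metis
  then show "A c * nrm v \<le> nrm (c *s v)"
    using absval_le_vnorm[of "c *s v" i] by (simp add: absval_mult)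
qed

lemma vnorm_add: "nrm (u + v) \<le> max (nrm u) (nrm v)"
  unfolding vnorm_le_iff
proof
  fix i
  have "A ((u + v) $ i) \<le> max (A (u $ i)) (A (v $ i))" using absval_add by simp
  also have "\<dots> \<le> max (nrm u) (nrm v)" by (intro max.mono absval_le_vnorm)
  finally show "A ((u + v) $ i) \<le> max (nrm u) (nrm v)" .
qed

lemma vnorm_minus [simp]: "nrm (- v) = nrm v"
  by (simp add: vnorm_def)

lemma vnorm_minus_commute: "nrm (u - v) = nrm (v - u)"
  using vnorm_minus[of "u - v"] by simp

lemma vnorm_add_less: "nrm u < b \<Longrightarrow> nrm v < b \<Longrightarrow> nrm (u + v) < b"
  using vnorm_add[of u v] by (simp add: max_def split: if_splits)

lemma vnorm_add_eq_max:
  fixes u v :: "'a ^ 'n::finite"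
  assumes "nrm u \<noteq> nrm v"
  shows "nrm (u + v) = max (nrm u) (nrm v)"
proof -
  have *: "nrm (u + v) = nrm v" if "nrm u < nrm v" for u v :: "'a ^ 'n"
    \<comment> \<open>Writing \<open>v\<close> as \<open>(u + v) - u\<close> bounds the longer
      summand by the norm of the sum, since \<open>u\<close> is too short to do so.\<close>
    using vnorm_add[of u v] vnorm_add[of "u + v" "- u"] that by (auto simp: max_def split: if_splits)
  show ?thesis
    using assms *[of u v] *[of v u] by (cases "nrm u < nrm v") (auto simp: add.commute)
qed

lemma vnorm_eq_of_diff_less:
  assumes "nrm (u - v) < nrm u"
  shows "nrm v = nrm u"
proof (rule ccontr)
  assume "nrm v \<noteq> nrm u"
  then have "nrm (u - v) = max (nrm u) (nrm v)"
    using vnorm_add_eq_max[of u "- v"] by simp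
  with assms show False by simp
qed

section \<open>Non-orthogonality as an equivalence relation\<close>

definition para :: "'a ^ 'n::finite \<Rightarrow> 'a ^ 'n \<Rightarrow> bool" where
  "para u v \<longleftrightarrow> (\<exists>c. nrm (u - c *s v) < nrm u)"

text \<open>The strict inequality already excludes \<open>u = 0\<close>. A vector closer to
  \<open>u\<close> than \<open>nrm u\<close> has the same norm as \<open>u\<close>, so
  \<open>A c * nrm v = nrm u\<close> and neither \<open>c\<close> nor \<open>v\<close>
  vanishes.\<close>

lemma paraE:
  assumes "para u v"
  obtains c where "c \<noteq> 0" "nrm (u - c *s v) < nrm u" "A c * nrm v = nrm u" "u \<noteq> 0" "v \<noteq> 0"
proof -
  obtain c where c: "nrm (u - c *s v) < nrm u" using assms para_def by metis
  then have "A c * nrm v = nrm u" using vnorm_eq_of_diff_less vnorm_scale by metis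
  moreover from c have "u \<noteq> 0" using order.strict_trans1[OF vnorm_nonneg c] by simp
  ultimately show ?thesis using that c
    by (metis mult_zero_left mult_zero_right absval_zero vnorm_eq_0_iff)
qed

lemma para_refl: "u \<noteq> 0 \<Longrightarrow> para u u"
  unfolding para_def by (intro exI[of _ 1]) simp

text \<open>Dividing \<open>u - c *s v\<close> by \<open>- c\<close> gives the difference for the
  swapped pair, and dividing by \<open>A c\<close> turns the bound \<open>nrm u\<close> into
  \<open>nrm v\<close>.\<close>

lemma para_sym:
  assumes "para u v"
  shows "para v u"
proof -
  obtain c where c: "c \<noteq> 0" "nrm (u - c *s v) < nrm u" "A c * nrm v = nrm u"
    using assms paraE by metis
  have "v - (1 / c) *s u = (- 1 / c) *s (u - c *s v)"
    using c(1) by (simp add: vec_eq_iff field_simps)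
  then have "nrm (v - (1 / c) *s u) = nrm (u - c *s v) / A c"
    by (simp only: vnorm_scale) (simp add: absval_divide)
  also have "\<dots> < nrm v" using c absval_pos[of c] by (simp add: field_simps)
  finally show ?thesis unfolding para_def by blast
qed

text \<open>\<open>u - (c * d) *s w\<close> splits into \<open>u - c *s v\<close> and
  \<open>c *s (v - d *s w)\<close>, both shorter than \<open>u\<close>.\<close>

lemma para_trans:
  assumes "para u v" "para v w"
  shows "para u w"
proof -
  obtain c where c: "c \<noteq> 0" "nrm (u - c *s v) < nrm u" "A c * nrm v = nrm u"
    using assms(1) paraE by metis
  obtain d where d: "nrm (v - d *s w) < nrm v" using assms(2) para_def by metis
  have "nrm (c *s (v - d *s w)) < nrm u"
    unfolding vnorm_scale c(3)[symmetric] using d absval_pos[OF c(1)] by (rule mult_strict_left_mono)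
  with c(2) have "nrm ((u - c *s v) + c *s (v - d *s w)) < nrm u"
    by (rule vnorm_add_less)
  moreover have "(u - c *s v) + c *s (v - d *s w) = u - (c * d) *s w"
    by (simp add: vec_eq_iff algebra_simps)
  ultimately show ?thesis unfolding para_def by metis
qed

lemma val_orthogonal_pair_iff:
  "val_orthogonal \<nu> [u, v] \<longleftrightarrow>
     u \<noteq> 0 \<and> v \<noteq> 0 \<and> (\<forall>a b. nrm (a *s u + b *s v) = max (nrm (a *s u)) (nrm (b *s v)))"
proof -
  have "(\<forall>c :: nat \<Rightarrow> 'a. P (c 0) (c 1)) \<longleftrightarrow> (\<forall>a b. P a b)" for P
  proof safe
    fix a b assume "\<forall>c :: nat \<Rightarrow> 'a. P (c 0) (c 1)"
    from spec[OF this, of "\<lambda>i. if i = 0 then a else b"] show "P a b" by simp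
  qed auto
  from this[of "\<lambda>a b. nrm (a *s u + b *s v) = max (nrm (a *s u)) (nrm (b *s v))"]
  show ?thesis
    by (simp add: val_orthogonal_def lessThan_Suc max.commute add.commute)
qed

text \<open>A witness \<open>c\<close> of \<open>para\<close> breaks orthogonality with coefficients
  1 and \<open>- c\<close>; failing coefficients \<open>a\<close>, \<open>b\<close> give the witness
  \<open>- b / a\<close>.\<close>

lemma val_orthogonal_iff_not_para:
  assumes "u \<noteq> 0" "v \<noteq> 0"
  shows "val_orthogonal \<nu> [u, v] \<longleftrightarrow> \<not> para u v"
proof
  assume orth: "val_orthogonal \<nu> [u, v]"
  show "\<not> para u v"
  proof
    assume "para u v"
    then obtain c where c: "nrm (u - c *s v) < nrm u" using para_def by metis
    have "nrm (1 *s u + (- c) *s v) = max (nrm (1 *s u)) (nrm ((- c) *s v))"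
      using orth val_orthogonal_pair_iff by metis
    moreover have "1 *s u + (- c) *s v = u - c *s v" by (simp add: vec_eq_iff)
    ultimately show False using c by simp
  qed
next
  assume np: "\<not> para u v"
  have "nrm (a *s u + b *s v) = max (nrm (a *s u)) (nrm (b *s v))" for a b
  proof (rule ccontr)
    assume neq: "\<not> ?thesis"
    \<comment> \<open>Only summands of equal norm can cancel, and then the sum is strictly shorter
      than either.\<close>
    then have eq: "nrm (a *s u) = nrm (b *s v)" using vnorm_add_eq_max by metis
    with neq vnorm_add[of "a *s u" "b *s v"] have less: "nrm (a *s u + b *s v) < nrm (a *s u)"
      by simp
    then have "0 < nrm (a *s u)" using vnorm_nonneg by (rule order.strict_trans1[rotated])
    then have "a \<noteq> 0" by auto
    then have "a *s u + b *s v = a *s (u - (- b / a) *s v)"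
      by (simp add: vec_eq_iff field_simps)
    with less have "A a * nrm (u - (- b / a) *s v) < A a * nrm u"
      by (simp only: vnorm_scale)
    then have "nrm (u - (- b / a) *s v) < nrm u"
      using absval_pos[OF \<open>a \<noteq> 0\<close>] by (simp only: mult_less_cancel_left_pos)
    with np show False unfolding para_def by blast
  qed
  with assms show "val_orthogonal \<nu> [u, v]" by (simp add: val_orthogonal_pair_iff)
qed

lemma para_scale:
  assumes "c \<noteq> 0" "v \<noteq> 0"
  shows "para (c *s v) v"
  using assms absval_pos[OF assms(1)]
  unfolding para_def by (intro exI[of _ c]) (simp add: vnorm_scale)

text \<open>The multiples \<open>x ^ n *s v\<close> have pairwise different norms when
  \<open>A x\<close> is neither 0 nor 1.\<close>

lemma infinite_para_class:
  assumes "v \<noteq> 0"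
  shows "infinite {u. para u v}"
proof -
  obtain x where x: "A x \<noteq> 0" "A x \<noteq> 1" using absval_nontrivial by auto
  have "inj (\<lambda>n. x ^ n *s v)"
  proof (rule injI)
    fix m n assume "x ^ m *s v = x ^ n *s v"
    then have "nrm (x ^ m *s v) = nrm (x ^ n *s v)" by (rule arg_cong)
    with assms have "A x ^ m = A x ^ n" by (simp add: vnorm_scale absval_power)
    then show "m = n" using x absval_pos[of x] by (simp add: power_inject_exp')
  qed
  then have "infinite (range (\<lambda>n. x ^ n *s v))" by (rule range_inj_infinite)
  moreover have "range (\<lambda>n. x ^ n *s v) \<subseteq> {u. para u v}"
    using para_scale[OF power_not_zero assms] x by auto
  ultimately show ?thesis using finite_subset by blast
qed

section \<open>Counting the classes\<close>

lemma card_vectors_over: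
  assumes "finite R"
  shows "card {v :: 'a ^ 'n::finite. \<forall>i. v $ i \<in> R} = card R ^ CARD('n)"
proof -
  have "bij_betw vec_lambda (PiE (UNIV :: 'n set) (\<lambda>_. R)) {v :: 'a ^ 'n. \<forall>i. v $ i \<in> R}"
    by (rule bij_betw_byWitness[where f' = vec_nth]) (auto simp: PiE_def)
  then have "card {v :: 'a ^ 'n. \<forall>i. v $ i \<in> R} = card (PiE (UNIV :: 'n set) (\<lambda>_. R))"
    by (simp add: bij_betw_same_card)
  then show ?thesis by (simp add: card_PiE)
qed

text \<open>Reducing modulo the maximal ideal, a class of pairwise non-orthogonal vectors becomes a line
  over the residue field, which has \<open>q - 1\<close> nonzero points.\<close>

lemma para_classes:
  obtains P :: "('a ^ 'n::finite) set"
  where "finite P" "0 \<notin> P" "card P = q ^ CARD('n) - 1"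
    "\<And>v. v \<noteq> 0 \<Longrightarrow> \<exists>p\<in>P. para v p"
    "\<And>p. p \<in> P \<Longrightarrow> card {p' \<in> P. para p' p} = q - 1"
proof -
  obtain R where R: "finite R" "card R = q" "0 \<in> R"
    and R_le: "\<And>r. r \<in> R \<Longrightarrow> A r \<le> 1"
    and ex: "\<And>x. A x \<le> 1 \<Longrightarrow> \<exists>r\<in>R. A (x - r) < 1"
    and uniq: "\<And>r s. r \<in> R \<Longrightarrow> s \<in> R \<Longrightarrow> A (r - s) < 1 \<Longrightarrow> r = s"
    using residue_representatives by blast
  obtain rep where rep: "\<And>x. A x \<le> 1 \<Longrightarrow> rep x \<in> R \<and> A (x - rep x) < 1"
    using ex by metis
  have R1: "A r = 1" if "r \<in> R" "r \<noteq> 0" for r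
    using uniq[of r 0] R_le[of r] that R by force
  \<comment> \<open>\<open>W\<close> models the space over the residue field, \<open>P\<close> its
    nonzero vectors, and \<open>red\<close> the coordinatewise reduction of vectors of norm at most
    1.\<close>
  define W where "W = {v :: 'a ^ 'n. \<forall>i. v $ i \<in> R}"
  define P where "P = W - {0}"
  define red where "red v = (\<chi> i. rep (v $ i))" for v :: "'a ^ 'n"
  have W_uniq: "u = v" if "u \<in> W" "v \<in> W" "nrm (u - v) < 1" for u v
    using that uniq by (auto simp: W_def vec_eq_iff vnorm_less_iff)
  have cardW: "card W = q ^ CARD('n)" using card_vectors_over R unfolding W_def by metis
  have finW: "finite W" using cardW q_ge_2 by (intro card_ge_0_finite) auto
  have nrmP: "nrm p = 1" if "p \<in> P" for p
  proof (rule antisym)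
    show "nrm p \<le> 1" using that R_le by (simp add: P_def W_def vnorm_le_iff)
    have "p \<noteq> 0" using that by (simp add: P_def)
    then obtain i where "p $ i \<noteq> 0" by (auto simp: vec_eq_iff)
    then have "A (p $ i) = 1" using that R1 by (simp add: P_def W_def)
    then show "1 \<le> nrm p" using absval_le_vnorm[of p i] by simp
  qed
  have red_close: "nrm (v - red v) < 1" if "nrm v \<le> 1" for v
    using that rep by (simp add: vnorm_less_iff vnorm_le_iff red_def)
  have red_P: "red v \<in> P" if "nrm v = 1" for v
  proof -
    have "red v \<in> W" using that rep by (simp add: W_def red_def vnorm_le_iff order_eq_iff)
    moreover have "red v \<noteq> 0" using red_close[of v] that by auto
    ultimately show ?thesis by (simp add: P_def)
  qed
  show ?thesis
  proof
    show "finite P" "0 \<notin> P" using finW by (auto simp: P_def)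
    have "0 \<in> W" using R by (simp add: W_def)
    then show "card P = q ^ CARD('n) - 1" using finW cardW by (simp add: P_def)
    show "\<exists>p\<in>P. para v p" if v: "v \<noteq> 0" for v
    proof -
      obtain i where i: "nrm v = A (v $ i)" using vnorm_attained by metis
      \<comment> \<open>Dividing by a coordinate of largest absolute value gives norm 1, where
        \<open>red_P\<close> applies.\<close>
      define c where "c = 1 / (v $ i)"
      have "nrm v \<noteq> 0" using v by simp
      with i have n0: "v $ i \<noteq> 0" by auto
      have c0: "c \<noteq> 0" using n0 by (simp add: c_def)
      have nc: "nrm (c *s v) = 1" using n0 i by (simp add: vnorm_scale c_def absval_divide)
      have "nrm (c *s v - 1 *s red (c *s v)) < nrm (c *s v)"
        using red_close[of "c *s v"] nc by simp
      then have "para (c *s v) (red (c *s v))" unfolding para_def by blast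
      then have "para v (red (c *s v))" using para_trans para_sym para_scale c0 v by blast
      with red_P[OF nc] show ?thesis by blast
    qed
    show "card {p' \<in> P. para p' p} = q - 1" if p: "p \<in> P" for p
    proof -
      have p1: "nrm p = 1" using nrmP p by blast
      have nc: "nrm (c *s p) = 1" if "c \<in> R - {0}" for c
        using that R1 p1 by (simp add: vnorm_scale)
      \<comment> \<open>The nonzero multiples of \<open>p\<close> over the residue field are exactly
        the nonzero points of its line.\<close>
      have "bij_betw (\<lambda>c. red (c *s p)) (R - {0}) {p' \<in> P. para p' p}"
        unfolding bij_betw_def
      proof (intro conjI inj_onI equalityI subsetI)
        fix c d assume cd: "c \<in> R - {0}" "d \<in> R - {0}" "red (c *s p) = red (d *s p)"
        \<comment> \<open>Both multiples are close to the same reduced vector, hence to each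
          other.\<close>
        have "nrm ((c *s p - red (c *s p)) + (red (d *s p) - d *s p)) < 1"
          using red_close[of "c *s p"] red_close[of "d *s p"] nc cd
          by (intro vnorm_add_less) (auto simp: vnorm_minus_commute)
        then have "nrm ((c - d) *s p) < 1" using cd(3) by (simp only: vector_sub_rdistrib) simp
        then have "A (c - d) < 1" using p1 by (simp only: vnorm_scale mult_1_right)
        with uniq cd show "c = d" by blast
      next
        fix p' assume "p' \<in> (\<lambda>c. red (c *s p)) ` (R - {0})"
        then obtain c where c: "c \<in> R - {0}" "p' = red (c *s p)" by auto
        have p': "p' \<in> P" using c red_P nc by blast
        have "nrm (p' - c *s p) < nrm p'"
          using red_close[of "c *s p"] nc[OF c(1)] nrmP[OF p'] c(2) by (simp add: vnorm_minus_commute)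
        with p' show "p' \<in> {p' \<in> P. para p' p}" unfolding para_def by blast
      next
        fix p' assume "p' \<in> {p' \<in> P. para p' p}"
        then have p': "p' \<in> P" "para p' p" by auto
        obtain c where c: "nrm (p' - c *s p) < nrm p'" "A c * nrm p = nrm p'"
          using p'(2) paraE by metis
        have Ac: "A c = 1" using c(2) p1 nrmP[OF p'(1)] by simp
        then have rc: "rep c \<in> R" "A (c - rep c) < 1" using rep by auto
        have "rep c \<noteq> 0" using rc Ac by auto
        then have rc': "rep c \<in> R - {0}" using rc by simp
        \<comment> \<open>Replacing \<open>c\<close> by its representative and then reducing each
          move the vector by less than 1, and members of \<open>W\<close> at distance less than 1
          coincide.\<close>
        have "nrm ((c - rep c) *s p) < 1" using rc p1 by (simp only: vnorm_scale mult_1_right)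
        then have "nrm ((p' - c *s p) + (c - rep c) *s p) < 1"
          using c nrmP[OF p'(1)] by (intro vnorm_add_less) auto
        then have "nrm (p' - rep c *s p) < 1" by (simp add: vector_sub_rdistrib)
        then have "nrm ((p' - rep c *s p) + (rep c *s p - red (rep c *s p))) < 1"
          using red_close nc[OF rc'] by (intro vnorm_add_less) auto
        then have "nrm (p' - red (rep c *s p)) < 1" by simp
        then have "p' = red (rep c *s p)"
          using W_uniq p'(1) red_P[OF nc[OF rc']] by (simp add: P_def)
        with rc' show "p' \<in> (\<lambda>c. red (c *s p)) ` (R - {0})" by blast
      qed
      then have "card {p' \<in> P. para p' p} = card (R - {0})" by (simp add: bij_betw_same_card)
      then show ?thesis using R by simp
    qed
  qed
qed

text \<open>\<open>P\<close> meets every class, and in exactly \<open>q - 1\<close> points, so the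
  number of classes times \<open>q - 1\<close> is \<open>q ^ CARD('n) - 1\<close>. The
  \<open>div\<close> is thus exact.\<close>

lemma exists_labelling:
  assumes "N = (q ^ CARD('n::finite) - 1) div (q - 1)"
  obtains f :: "'a ^ 'n \<Rightarrow> nat"
  where "\<And>v. v \<noteq> 0 \<Longrightarrow> f v \<in> {1..N}" "\<And>i. i \<in> {1..N} \<Longrightarrow> \<exists>v. v \<noteq> 0 \<and> f v = i"
    "\<And>u v. u \<noteq> 0 \<Longrightarrow> v \<noteq> 0 \<Longrightarrow> f u = f v \<longleftrightarrow> para u v"
proof -
  obtain P :: "('a ^ 'n) set" where P: "finite P" "0 \<notin> P" "card P = q ^ CARD('n) - 1"
    and meet: "\<And>v. v \<noteq> 0 \<Longrightarrow> \<exists>p\<in>P. para v p"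
    and size: "\<And>p. p \<in> P \<Longrightarrow> card {p' \<in> P. para p' p} = q - 1"
    using para_classes by blast
  \<comment> \<open>The trace of a class on the finite set \<open>P\<close> serves as its canonical
    name; \<open>h\<close> below numbers these traces.\<close>
  define cl where "cl v = {p \<in> P. para p v}" for v
  have cl_eq: "cl u = cl v \<longleftrightarrow> para u v" if "u \<noteq> 0" "v \<noteq> 0" for u v
  proof
    assume "cl u = cl v"
    moreover obtain p where "p \<in> P" "para u p" using meet \<open>u \<noteq> 0\<close> by blast
    ultimately have "para p v" using para_sym unfolding cl_def by blast
    with \<open>para u p\<close> show "para u v" using para_trans by blast
  next
    assume "para u v"
    then have "para p u \<longleftrightarrow> para p v" for p using para_sym para_trans by blast
    then show "cl u = cl v" by (simp add: cl_def)
  qed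
  have P_nz: "p \<noteq> 0" if "p \<in> P" for p using P that by auto
  let ?Q = "cl ` P"
  have finQ: "finite ?Q" using P by simp
  have "card (\<Union>?Q) = card ?Q * (q - 1)"
  proof -
    have "(q - 1) * card ?Q = card (\<Union>?Q)"
    proof (rule card_partition)
      show "finite (\<Union>?Q)" using P by (auto simp: cl_def)
      show "card c = q - 1" if "c \<in> ?Q" for c using that size by (auto simp: cl_def)
      show "c1 \<inter> c2 = {}" if c12: "c1 \<in> ?Q" "c2 \<in> ?Q" "c1 \<noteq> c2" for c1 c2
      proof (rule ccontr)
        assume "c1 \<inter> c2 \<noteq> {}"
        moreover obtain p1 p2 where p: "p1 \<in> P" "p2 \<in> P" "c1 = cl p1" "c2 = cl p2"
          using c12(1,2) by blast
        ultimately obtain p where "para p p1" "para p p2" unfolding cl_def by blast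
        then have "para p1 p2" using para_sym para_trans by blast
        with p c12(3) cl_eq P_nz show False by metis
      qed
    qed (fact finQ)
    then show ?thesis by (simp add: mult.commute)
  qed
  moreover have "\<Union>?Q = P" using P_nz para_refl by (auto simp: cl_def)
  ultimately have "card ?Q = N" using P assms q_ge_2 by simp
  then obtain h where h: "bij_betw h ?Q {1..N}"
    using finQ finite_same_card_bij[of ?Q "{1..N}"] by auto
  have cl_Q: "cl v \<in> ?Q" if "v \<noteq> 0" for v
    using meet[OF that] cl_eq[OF that] P_nz by blast
  show ?thesis
  proof
    show "(h \<circ> cl) v \<in> {1..N}" if "v \<noteq> 0" for v
      using cl_Q[OF that] h by (auto simp: bij_betw_def)
    show "\<exists>v. v \<noteq> 0 \<and> (h \<circ> cl) v = i" if "i \<in> {1..N}" for i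
    proof -
      have "i \<in> h ` ?Q" using h that by (simp add: bij_betw_def)
      with P_nz show ?thesis by auto
    qed
    show "(h \<circ> cl) u = (h \<circ> cl) v \<longleftrightarrow> para u v" if "u \<noteq> 0" "v \<noteq> 0" for u v
      using inj_on_eq_iff[OF bij_betw_imp_inj_on[OF h] cl_Q[OF that(1)] cl_Q[OF that(2)]]
        cl_eq[OF that] by simp
  qed
qed

end

section \<open>From labels to weakly orthogonal sets\<close>

lemma weakly_orthogonal_iff_inj_on:
  assumes "\<And>u v. u \<noteq> 0 \<Longrightarrow> v \<noteq> 0 \<Longrightarrow> f u = f v \<longleftrightarrow> valued_field.para \<nu> u v"
    and "valued_field \<nu>"
  shows "weakly_orthogonal \<nu> F \<longleftrightarrow> 0 \<notin> F \<and> inj_on f F"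
proof -
  have "val_orthogonal \<nu> [u, v] \<longleftrightarrow> f u \<noteq> f v" if "u \<noteq> 0" "v \<noteq> 0" for u v
    using valued_field.val_orthogonal_iff_not_para[OF assms(2) that] assms(1)[OF that] by simp
  then show ?thesis
    unfolding weakly_orthogonal_def inj_on_def by metis
qed

text \<open>The guard \<open>l - 1 \<le> N\<close> is essential: beyond it \<open>Delta\<close>
  equals \<open>k - 1\<close>, which exceeds the upper bound, and the feasible sums are unbounded.
  For \<open>l = 2\<close> the guard reads \<open>1 \<le> N\<close>, which always holds.\<close>

theorem theorem1p10:
  fixes \<nu> :: "'a::field \<Rightarrow> int extended" and q k l N :: nat
  assumes "discrete_valuation \<nu>"
    and "finite (residue_field \<nu>)"
    and "q = card (residue_field \<nu>)"
    and "k \<ge> l" and "l \<ge> 2"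
    and "N = (q ^ CARD('n::finite) - 1) div (q - 1)"
  shows "Delta_exists TYPE('n) \<nu> k l \<and>
    \<lfloor>(real k - 1) / (real l - 1)\<rfloor> * int N \<le> int (Delta TYPE('n) \<nu> k l) \<and>
    (l - 1 \<le> N \<longrightarrow>
       int (Delta TYPE('n) \<nu> k l) \<le> \<lfloor>(real k - 1) / (real l - 1) * real N\<rfloor> \<and>
       finite (admissible_sums N k l) \<and>
       Delta TYPE('n) \<nu> k l = Max (admissible_sums N k l) \<and>
       (l - 1 dvd k - 1 \<longrightarrow>
          real (Delta TYPE('n) \<nu> k l) = (real k - 1) / (real l - 1) * real N)) \<and>
    Delta_exists TYPE('n) \<nu> k 2 \<and>
    Delta TYPE('n) \<nu> k 2 = (k - 1) * N"
proof -
  interpret K: valued_field \<nu> using assms(1,2) by unfold_locales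
  obtain f :: "'a ^ 'n \<Rightarrow> nat"
    where f: "\<And>v. v \<noteq> 0 \<Longrightarrow> f v \<in> {1..N}" "\<And>i. i \<in> {1..N} \<Longrightarrow> \<exists>v. v \<noteq> 0 \<and> f v = i"
    and f_eq: "\<And>u v. u \<noteq> 0 \<Longrightarrow> v \<noteq> 0 \<Longrightarrow> f u = f v \<longleftrightarrow> K.para u v"
    by (fact K.exists_labelling[OF assms(6)[unfolded assms(3)]])
  interpret L: labelling "- {0}" f N
  proof
    show "f v \<in> {1..N}" if "v \<in> - {0}" for v using f(1)[of v] that by simp
    show "infinite {v \<in> - {0}. f v = i}" if i: "i \<in> {1..N}" for i
    proof -
      obtain v where v: "v \<noteq> 0" "f v = i" using f(2)[OF i] by blast
      have "{u. K.para u v} \<subseteq> {u \<in> - {0}. f u = i}"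
      proof
        fix u assume "u \<in> {u. K.para u v}"
        then have uv: "K.para u v" by simp
        then have "u \<noteq> 0" by (rule K.paraE)
        then show "u \<in> {u \<in> - {0}. f u = i}" using f_eq[OF _ v(1), of u] uv v(2) by simp
      qed
      then show ?thesis using K.infinite_para_class[OF v(1)] by (rule infinite_super)
    qed
  qed
  have "N > 0"
  proof -
    \<comment> \<open>The all-ones vector is nonzero, so its label shows that \<open>{1..N}\<close>
      is nonempty.\<close>
    have "(1 :: 'a ^ 'n) \<noteq> 0" by (simp add: vec_eq_iff)
    with f(1)[of 1] show ?thesis by auto
  qed
  have kl: "kl_weakly_orthogonal \<nu> k l = L.spread k l" for k l
  proof
    fix S :: "('a ^ 'n) set"
    have "weakly_orthogonal \<nu> F \<longleftrightarrow> 0 \<notin> F \<and> inj_on f F" for F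
      using f_eq K.valued_field_axioms by (rule weakly_orthogonal_iff_inj_on)
    then have "(\<exists>F\<subseteq>E. card F = l \<and> weakly_orthogonal \<nu> F) \<longleftrightarrow> (\<exists>F\<subseteq>E. card F = l \<and> inj_on f F)"
      if "0 \<notin> S" "E \<subseteq> S" for E
      using that by (metis subsetD)
    then show "kl_weakly_orthogonal \<nu> k l S = L.spread k l S"
      unfolding kl_weakly_orthogonal_def L.spread_def
      by (auto simp: subset_Compl_singleton cong: imp_cong)
  qed
  \<comment> \<open>From here on the facts are general in \<open>l\<close>, as they are used both
    for the given \<open>l\<close> and for 2.\<close>
  have fin: "finite (card ` {S. L.spread k l S})" if "l \<ge> 2" "k \<ge> l" for l
    using that \<open>N > 0\<close> L.card_spread[OF that] L.card_spread_degenerate[OF that]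
      finite_admissible_sums[OF that(1)] by (cases "l - 1 \<le> N") auto
  have ex: "Delta_exists TYPE('n) \<nu> k l" if "l \<ge> 2" "k \<ge> l" for l
    using fin[OF that] L.spread_finite that unfolding Delta_exists_def kl by blast
  have Delta_eq: "Delta TYPE('n) \<nu> k l = Max (admissible_sums N k l)"
    if "l \<ge> 2" "k \<ge> l" "l - 1 \<le> N" for l
    using L.card_spread[OF that] by (simp add: Delta_def kl)
  have lower: "((k - 1) div (l - 1)) * N \<le> Delta TYPE('n) \<nu> k l" if "l \<ge> 2" "k \<ge> l" for l
  proof (cases "l - 1 \<le> N")
    case True
    show ?thesis
      unfolding Delta_eq[OF that True]
      by (intro Max_ge finite_admissible_sums admissible_sums_constant that(1) True)
  next
    case False
    \<comment> \<open>Beyond the guard the largest size is \<open>k - 1\<close>, which still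
      dominates the lower bound because \<open>N < l - 1\<close>.\<close>
    then have "Delta TYPE('n) \<nu> k l = k - 1"
      using L.card_spread_degenerate[OF that] \<open>N > 0\<close> by (simp add: Delta_def kl Max_eq_iff)
    moreover have "((k - 1) div (l - 1)) * N \<le> ((k - 1) div (l - 1)) * (l - 1)"
      using False by (intro mult_left_mono) auto
    moreover have "(k - 1) div (l - 1) * (l - 1) \<le> k - 1" by (rule div_times_less_eq_dividend)
    ultimately show ?thesis by linarith
  qed
  have upper: "(l - 1) * Delta TYPE('n) \<nu> k l \<le> (k - 1) * N"
    if "l \<ge> 2" "k \<ge> l" "l - 1 \<le> N" for l
  proof -
    have "Max (admissible_sums N k l) \<in> admissible_sums N k l"
      using finite_admissible_sums[OF that(1,3)] admissible_sums_constant by (intro Max_in) blast+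
    then show ?thesis
      unfolding Delta_eq[OF that] using that(3) \<open>N > 0\<close> by (rule admissible_sums_upper)
  qed
  have real_eq: "real k - 1 = real (k - 1)" "real l - 1 = real (l - 1)"
    using assms by auto
  have floor_le: "\<lfloor>(real k - 1) / (real l - 1)\<rfloor> * int N \<le> int (Delta TYPE('n) \<nu> k l)"
    using lower[OF assms(5,4)] unfolding real_eq floor_divide_of_nat_eq by (metis of_nat_le_iff of_nat_mult)
  have upper_real: "real (Delta TYPE('n) \<nu> k l) \<le> (real k - 1) / (real l - 1) * real N"
    if "l - 1 \<le> N"
  proof -
    have "real (l - 1) * real (Delta TYPE('n) \<nu> k l) \<le> real (k - 1) * real N"
      using upper[OF assms(5,4) that] by (metis of_nat_le_iff of_nat_mult)
    then show ?thesis using assms(5) unfolding real_eq by (simp add: field_simps)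
  qed
  have divisible: "real (Delta TYPE('n) \<nu> k l) = (real k - 1) / (real l - 1) * real N"
    if "l - 1 \<le> N" "l - 1 dvd k - 1"
  proof (rule antisym)
    \<comment> \<open>Divisibility makes the quotient in the lower bound exact, so it meets the
      upper bound.\<close>
    have "(real k - 1) / (real l - 1) * real N = real (((k - 1) div (l - 1)) * N)"
      unfolding real_eq using that by (simp add: real_of_nat_div)
    then show "(real k - 1) / (real l - 1) * real N \<le> real (Delta TYPE('n) \<nu> k l)"
      using lower[OF assms(5,4)] by (simp only: of_nat_le_iff)
  qed (fact upper_real[OF that(1)])
  \<comment> \<open>For \<open>l = 2\<close> the divisor is 1, so both bounds are
    \<open>(k - 1) * N\<close>.\<close>
  have "Delta TYPE('n) \<nu> k 2 = (k - 1) * N"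
    using lower[of 2] upper[of 2] assms(4,5) \<open>N > 0\<close> by simp
  then show ?thesis
    using ex[OF assms(5,4)] ex[of 2] floor_le upper_real divisible Delta_eq[OF assms(5,4)]
      finite_admissible_sums[OF assms(5)] assms(4,5)
    by (simp add: le_floor_iff)
qed

end
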